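(* Let $v\in V$ with $v\neq 0_V$. Then the creator operator $a^+_v:\mathcal{P}\to\mathcal{P}$ is injective, i.e. for every $n\in\mathbb{N}$ and every $\xi_n\in\mathcal{P}_n$, $$a^+_v\xi_n=0\ \Rightarrow\ \xi_n=0 .$$
   Context: Let $d\in\mathbb{N}$, $d\ge 1$, and let $\mathcal{P}=\mathbb{C}[X_1,\dots,X_d]$ be the complex polynomial $*$-algebra in $d$ commuting indeterminates, with the involution for which each $X_j$ is self-adjoint. For $n\in\mathbb{N}$, $\mathcal{P}_{n]}$ denotes the linear span of all monomials of degree $\le n$, and $\mathcal{P}_{-1]}=\{0\}$. A state $\varphi$ on $\mathcal{P}$ (a linear functional with $\varphi(1)=1$ and $\varphi(a^*a)\ge 0$ for all $a\in\mathcal{P}$) is fixed. It defines the (possibly degenerate) pre-scalar product $\langle a,b\rangle=\varphi(a^*b)$. Associated with $\varphi$ is the $\varphi$-orthogonal polynomial decomposition, a vector space direct sum $\mathcal{P}=\bigoplus_{n\in\mathbb{N}}\mathcal{P}_n$ (algebraic, each element having finitely many nonzero components) such that: (i) $\mathcal{P}_m\perp\mathcal{P}_n$ for $\langle\cdot,\cdot\rangle$ whenever $m\ne n$; (ii) $\mathcal{P}_{n]}=\bigoplus_{h=0}^n\mathcal{P}_h$ for all $n$; (iii) each $\mathcal{P}_n\subset\mathcal{P}_{n]}$ is monic of degree $n$, i.e. $\mathcal{P}_{n]}=\mathcal{P}_{n-1]}\oplus\mathcal{P}_n$ (vector space direct sum) and $\mathcal{P}_n$ has a linear basis each of whose elements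 has as highest order term a multiple of a single monomial of degree $n$. Let $P_n:\mathcal{P}\to\mathcal{P}_n$ denote the projector onto $\mathcal{P}_n$ associated with this decomposition. For $1\le j\le d$ and $n\in\mathbb{N}$ put $a^+_{j|n}:=P_{n+1}X_jP_n|_{\mathcal{P}_n}:\mathcal{P}_n\to\mathcal{P}_{n+1}$ (where $X_j$ acts by multiplication), and $a^+_j:=\sum_{n\in\mathbb{N}}a^+_{j|n}$, i.e. the linear operator on $\mathcal{P}$ whose restriction to $\mathcal{P}_n$ is $a^+_{j|n}$. Let $V$ be a complex Hilbert space of dimension $d$ with a fixed basis $(e_j)_{1\le j\le d}$. For $v=\sum_{j=1}^d b_je_j\in V$ put $a^+_v:=\sum_{j=1}^d b_ja^+_j$. *)

theory Defs
  imports
    "HOL-Analysis.Analysis"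
    "HOL-Library.Poly_Mapping"
    "HOL-Library.Nonpos_Ints"
begin

section \<open>The polynomial *-algebra in d commuting indeterminates\<close>

text \<open>
  The indeterminates are indexed by a finite type \<open>'d\<close>, so that \<open>d = CARD('d) \<ge> 1\<close>.
  A monomial is given by its exponents \<open>'d \<Rightarrow>\<^sub>0 nat\<close> and a polynomial by its coefficients;
  the ring structure is the convolution product of \<open>Poly_Mapping\<close>.
\<close>

type_synonym 'd cpoly = "('d \<Rightarrow>\<^sub>0 nat) \<Rightarrow>\<^sub>0 complex"

definition cpoly_scale :: "complex \<Rightarrow> 'd cpoly \<Rightarrow> 'd cpoly" where
  "cpoly_scale c p = Poly_Mapping.map (\<lambda>z. c * z) p"

lemma lookup_cpoly_scale: "Poly_Mapping.lookup (cpoly_scale c p) m = c * Poly_Mapping.lookup p m"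
  unfolding cpoly_scale_def by (simp add: map.rep_eq when_def)

global_interpretation cpoly: vector_space "cpoly_scale :: complex \<Rightarrow> 'd cpoly \<Rightarrow> 'd cpoly"
  by standard
    (rule poly_mapping_eqI, simp add: lookup_cpoly_scale lookup_add algebra_simps)+

definition cpoly_star :: "'d cpoly \<Rightarrow> 'd cpoly" where
  "cpoly_star p = Poly_Mapping.map cnj p"

definition monomial :: "('d \<Rightarrow>\<^sub>0 nat) \<Rightarrow> 'd cpoly" where
  "monomial m = Poly_Mapping.single m 1"

definition mdegree :: "('d::finite \<Rightarrow>\<^sub>0 nat) \<Rightarrow> nat" where
  "mdegree m = (\<Sum>j\<in>UNIV. Poly_Mapping.lookup m j)"

definition indet :: "'d \<Rightarrow> 'd cpoly" where
  "indet j = monomial (Poly_Mapping.single j 1)"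

text \<open>The bound is an integer so that the case \<open>n = - 1\<close> gives \<open>span {} = {0}\<close>.\<close>

definition polys_upto :: "int \<Rightarrow> ('d::finite) cpoly set" where
  "polys_upto n = cpoly.span {monomial m | m. int (mdegree m) \<le> n}"


section \<open>States and orthogonal decompositions\<close>

definition is_state :: "('d cpoly \<Rightarrow> complex) \<Rightarrow> bool" where
  "is_state \<phi> \<longleftrightarrow>
     Vector_Spaces.linear cpoly_scale (\<lambda>c z. c * z) \<phi> \<and>
     \<phi> 1 = 1 \<and>
     (\<forall>a. \<phi> (cpoly_star a * a) \<in> \<real>\<^sub>\<ge>\<^sub>0)"

definition pre_scalar :: "('d cpoly \<Rightarrow> complex) \<Rightarrow> 'd cpoly \<Rightarrow> 'd cpoly \<Rightarrow> complex" where
  "pre_scalar \<phi> a b = \<phi> (cpoly_star a * b)"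

definition is_decomp :: "'i set \<Rightarrow> ('i \<Rightarrow> 'd cpoly set) \<Rightarrow> 'd cpoly \<Rightarrow> ('i \<Rightarrow> 'd cpoly) \<Rightarrow> bool" where
  "is_decomp I F p f \<longleftrightarrow>
     (\<forall>i\<in>I. f i \<in> F i) \<and> (\<forall>i. i \<notin> I \<longrightarrow> f i = 0) \<and>
     finite {i. f i \<noteq> 0} \<and> p = (\<Sum>i | f i \<noteq> 0. f i)"

definition is_direct_sum :: "'i set \<Rightarrow> ('i \<Rightarrow> 'd cpoly set) \<Rightarrow> 'd cpoly set \<Rightarrow> bool" where
  "is_direct_sum I F W \<longleftrightarrow>
     (\<forall>i\<in>I. cpoly.subspace (F i)) \<and>
     W = {p. \<exists>f. is_decomp I F p f} \<and>
     (\<forall>p\<in>W. \<exists>!f. is_decomp I F p f)"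

text \<open>
  The two-term direct sum of \<open>polys_upto (n - 1)\<close> and \<open>D\<close> is the one indexed by \<open>bool\<close>.
  In the basis condition, \<open>c * monomial m\<close> is the highest order term of \<open>b\<close>.
\<close>

definition is_monic :: "nat \<Rightarrow> ('d::finite) cpoly set \<Rightarrow> bool" where
  "is_monic n D \<longleftrightarrow>
     D \<subseteq> polys_upto (int n) \<and>
     is_direct_sum UNIV (case_bool (polys_upto (int n - 1)) D) (polys_upto (int n)) \<and>
     (\<exists>B. cpoly.independent B \<and> cpoly.span B = D \<and>
        (\<forall>b\<in>B. \<exists>m c. mdegree m = n \<and> c \<noteq> 0 \<and>
           b - cpoly_scale c (monomial m) \<in> polys_upto (int n - 1)))"

definition orthogonal_poly_decomposition ::
    "(('d::finite) cpoly \<Rightarrow> complex) \<Rightarrow> (nat \<Rightarrow> 'd cpoly set) \<Rightarrow> bool" where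
  "orthogonal_poly_decomposition \<phi> P \<longleftrightarrow>
     is_direct_sum UNIV P UNIV \<and>
     (\<forall>m n. m \<noteq> n \<longrightarrow> (\<forall>a\<in>P m. \<forall>b\<in>P n. pre_scalar \<phi> a b = 0)) \<and>
     (\<forall>n. is_direct_sum {0..n} P (polys_upto (int n))) \<and>
     (\<forall>n. is_monic n (P n))"


section \<open>Creation operators\<close>

definition projector :: "(nat \<Rightarrow> 'd cpoly set) \<Rightarrow> nat \<Rightarrow> 'd cpoly \<Rightarrow> 'd cpoly" where
  "projector P n p = (THE f. is_decomp UNIV P p f) n"

definition creator_at :: "(nat \<Rightarrow> 'd cpoly set) \<Rightarrow> 'd \<Rightarrow> nat \<Rightarrow> 'd cpoly \<Rightarrow> 'd cpoly" where
  "creator_at P j n \<xi> = projector P (Suc n) (indet j * projector P n \<xi>)"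

text \<open>For a direct sum decomposition only finitely many \<open>projector P n p\<close> are nonzero.\<close>

definition creator :: "(nat \<Rightarrow> 'd cpoly set) \<Rightarrow> 'd \<Rightarrow> 'd cpoly \<Rightarrow> 'd cpoly" where
  "creator P j p =
     (\<Sum>n | projector P n p \<noteq> 0. creator_at P j n (projector P n p))"


section \<open>Complex Hilbert spaces\<close>

locale complex_hilbert_space = vector_space scaleV
  for scaleV :: "complex \<Rightarrow> 'v::ab_group_add \<Rightarrow> 'v" +
  fixes cinner :: "'v \<Rightarrow> 'v \<Rightarrow> complex"
  assumes cinner_add_right: "cinner x (y + z) = cinner x y + cinner x z"
    and cinner_scale_right: "cinner x (scaleV c y) = c * cinner x y"
    and cinner_commute: "cinner y x = cnj (cinner x y)"
    and cinner_nonneg: "cinner x x \<in> \<real>\<^sub>\<ge>\<^sub>0"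
    and cinner_eq_zero: "cinner x x = 0 \<Longrightarrow> x = 0"
    and complete:
      "(\<forall>\<epsilon>>0. \<exists>N. \<forall>m\<ge>N. \<forall>n\<ge>N. sqrt (Re (cinner (f m - f n) (f m - f n))) < \<epsilon>) \<Longrightarrow>
       \<exists>l. (\<lambda>n::nat. sqrt (Re (cinner (f n - l) (f n - l)))) \<longlonglongrightarrow> 0"

definition is_indexed_basis :: "(complex \<Rightarrow> 'v::ab_group_add \<Rightarrow> 'v) \<Rightarrow> ('d \<Rightarrow> 'v) \<Rightarrow> bool" where
  "is_indexed_basis scaleV e \<longleftrightarrow>
     inj e \<and> \<not> module.dependent scaleV (range e) \<and> module.span scaleV (range e) = UNIV"

text \<open>
  \<open>representation (range e) v (e j)\<close> is the coefficient \<open>b\<^sub>j\<close> in \<open>v = (\<Sum>j. b\<^sub>j e\<^sub>j)\<close>.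
\<close>

definition creator_vec ::
    "(complex \<Rightarrow> 'v::ab_group_add \<Rightarrow> 'v) \<Rightarrow> (('d::finite) \<Rightarrow> 'v) \<Rightarrow> (nat \<Rightarrow> 'd cpoly set) \<Rightarrow>
     'v \<Rightarrow> 'd cpoly \<Rightarrow> 'd cpoly" where
  "creator_vec scaleV e P v p =
     (\<Sum>j\<in>UNIV. cpoly_scale (module.representation scaleV (range e) v (e j)) (creator P j p))"

end

theory Submission
  imports Defs
begin

text \<open>
  The creation operator is multiplication by the linear form \<open>L = \<Sum>j b\<^sub>j X\<^sub>j\<close>, followed on each
  \<open>P n\<close> by the projection onto \<open>P (n + 1)\<close>; here \<open>b\<^sub>j\<close> are the coordinates of \<open>v\<close>. For
  \<open>\<xi> \<in> P n\<close> the product \<open>L \<xi>\<close> has degree at most \<open>n + 1\<close>, and its component in \<open>P (n + 1)\<close>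
  vanishes exactly when its degree is at most \<open>n\<close>. A nonzero \<open>\<xi> \<in> P n\<close> has degree exactly \<open>n\<close>,
  because \<open>P n\<close> meets the polynomials of lower degree only in \<open>0\<close>. So the claim for a single
  \<open>\<xi>\<close> reduces to the fact that multiplication by a nonzero linear form raises the degree
  (\<open>linear_form_mult_raises_degree\<close>), which is seen on one well-chosen coefficient. This gives
  injectivity on each \<open>P n\<close> (\<open>raising_injective_on_component\<close>).

  Injectivity on all polynomials follows since the operator shifts the grading by one: the component
  of index \<open>n + 1\<close> of the image depends on the component of index \<open>n\<close> of the argument only
  (\<open>projector_creator_vec\<close>), so every component can be recovered from the image.
\<close>

section \<open>Degrees and coefficients\<close>

lemma mdegree_add: "mdegree (m + k) = mdegree m + mdegree k"
  by (simp add: mdegree_def lookup_add sum.distrib)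

lemma mdegree_single [simp]: "mdegree (Poly_Mapping.single j n) = n"
  by (simp add: mdegree_def lookup_single when_def)

lemma sum_single_lookup:
  "(\<Sum>m\<in>Poly_Mapping.keys p. Poly_Mapping.single m (Poly_Mapping.lookup p m)) = p"
  by (rule poly_mapping_eqI) (auto simp: lookup_sum lookup_single when_def in_keys_iff)

lemma mem_polys_upto_iff:
  "p \<in> polys_upto n \<longleftrightarrow> (\<forall>m\<in>Poly_Mapping.keys p. int (mdegree m) \<le> n)"
proof
  let ?W = "{p. \<forall>m\<in>Poly_Mapping.keys p. int (mdegree m) \<le> n}"
  have "cpoly.subspace ?W"
    unfolding cpoly.subspace_def
    by (auto simp: in_keys_iff lookup_add lookup_cpoly_scale)
  moreover have "{monomial m | m. int (mdegree m) \<le> n} \<subseteq> ?W"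
    by (auto simp: monomial_def)
  ultimately have "polys_upto n \<subseteq> ?W"
    unfolding polys_upto_def by (intro cpoly.span_minimal)
  then show "p \<in> polys_upto n \<Longrightarrow> \<forall>m\<in>Poly_Mapping.keys p. int (mdegree m) \<le> n" by blast
next
  assume deg: "\<forall>m\<in>Poly_Mapping.keys p. int (mdegree m) \<le> n"
  have single_eq: "Poly_Mapping.single m c = cpoly_scale c (monomial m)" for m and c :: complex
    by (rule poly_mapping_eqI) (simp add: lookup_cpoly_scale monomial_def lookup_single when_def)
  have "p = (\<Sum>m\<in>Poly_Mapping.keys p. cpoly_scale (Poly_Mapping.lookup p m) (monomial m))"
    using sum_single_lookup[of p] unfolding single_eq by (rule sym)
  also have "\<dots> \<in> polys_upto n"
    unfolding polys_upto_def using deg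
    by (intro cpoly.span_sum cpoly.span_scale cpoly.span_base) auto
  finally show "p \<in> polys_upto n" .
qed

lemma lookup_indet_mult:
  "Poly_Mapping.lookup (indet j * p) k =
     (\<Sum>m\<in>Poly_Mapping.keys p. Poly_Mapping.lookup p m when Poly_Mapping.single j 1 + m = k)"
proof -
  have "indet j * p = indet j *
      (\<Sum>m\<in>Poly_Mapping.keys p. Poly_Mapping.single m (Poly_Mapping.lookup p m))"
    by (simp add: sum_single_lookup)
  then show ?thesis
    by (simp add: sum_distrib_left indet_def monomial_def mult_single lookup_sum lookup_single)
qed

lemma lookup_indet_mult_shift:
  "Poly_Mapping.lookup (indet j * p) (Poly_Mapping.single j 1 + m) = Poly_Mapping.lookup p m"
  by (simp add: lookup_indet_mult when_def in_keys_iff)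

lemma cpoly_scale_mult: "cpoly_scale c p * q = cpoly_scale c (p * q)"
  unfolding cpoly_scale_def mult_map_scale_conv_mult by (simp add: mult.assoc)

definition linear_form :: "('d::finite \<Rightarrow> complex) \<Rightarrow> 'd cpoly" where
  "linear_form b = (\<Sum>j\<in>UNIV. cpoly_scale (b j) (indet j))"

lemma linear_form_mult:
  "linear_form b * p = (\<Sum>j\<in>UNIV. cpoly_scale (b j) (indet j * p))"
  by (simp add: linear_form_def sum_distrib_right cpoly_scale_mult)

lemma indet_mult_mem_polys_upto:
  assumes "p \<in> polys_upto n"
  shows "indet j * p \<in> polys_upto (n + 1)"
proof -
  have "mdegree k \<le> n + 1" if "k \<in> Poly_Mapping.keys (indet j * p)" for k
  proof -
    from that obtain m where "m \<in> Poly_Mapping.keys p" "Poly_Mapping.single j 1 + m = k"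
      using keys_mult[of "indet j" p] by (auto simp: indet_def monomial_def)
    then show ?thesis
      using assms by (auto simp: mem_polys_upto_iff mdegree_add)
  qed
  then show ?thesis by (simp add: mem_polys_upto_iff)
qed

lemma linear_form_mult_mem_polys_upto:
  "p \<in> polys_upto n \<Longrightarrow> linear_form b * p \<in> polys_upto (n + 1)"
  unfolding linear_form_mult using indet_mult_mem_polys_upto[of p n]
  by (auto simp: polys_upto_def intro!: cpoly.span_sum cpoly.span_scale)

text \<open>
  If \<open>b i \<noteq> 0\<close>, take a monomial \<open>m\<close> of top degree in \<open>p\<close> whose exponent of \<open>X\<^sub>i\<close> is maximal. A
  contribution of another indeterminate \<open>X\<^sub>j\<close> to the coefficient of \<open>X\<^sub>i m\<close> would come from the
  monomial \<open>X\<^sub>i m / X\<^sub>j\<close>, which has the same degree as \<open>m\<close> but a larger exponent of \<open>X\<^sub>i\<close>. Hence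
  that coefficient is \<open>b i\<close> times the coefficient of \<open>m\<close>, and no cancellation can occur.
\<close>

lemma linear_form_mult_raises_degree:
  assumes b: "b i \<noteq> 0"
    and p: "p \<in> polys_upto (int n)"
    and Lp: "linear_form b * p \<in> polys_upto (int n)"
  shows "p \<in> polys_upto (int n - 1)"
proof (rule ccontr)
  assume "p \<notin> polys_upto (int n - 1)"
  define T where "T = {m \<in> Poly_Mapping.keys p. mdegree m = n}"
  have "finite T" "T \<noteq> {}"
    using p \<open>p \<notin> polys_upto (int n - 1)\<close> by (force simp: T_def mem_polys_upto_iff)+
  let ?E = "(\<lambda>m. Poly_Mapping.lookup m i) ` T"
  have E: "finite ?E" "?E \<noteq> {}" using \<open>finite T\<close> \<open>T \<noteq> {}\<close> by simp_all
  then obtain m where m: "m \<in> T" and "Poly_Mapping.lookup m i = Max ?E"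
    using Max_in by (metis (lifting) imageE)
  then have m_max: "Poly_Mapping.lookup k i \<le> Poly_Mapping.lookup m i" if "k \<in> T" for k
    using that Max_ge[OF E(1)] by simp
  let ?k = "Poly_Mapping.single i 1 + m"
  have "Poly_Mapping.lookup (indet j * p) ?k = 0" if "j \<noteq> i" for j
  proof -
    have "Poly_Mapping.single j 1 + l \<noteq> ?k" if l: "l \<in> Poly_Mapping.keys p" for l
    proof
      assume eq: "Poly_Mapping.single j 1 + l = ?k"
      then have "mdegree l = mdegree m"
        using mdegree_add[of "Poly_Mapping.single j 1" l]
          mdegree_add[of "Poly_Mapping.single i 1" m] by simp
      then have "l \<in> T" using l m by (simp add: T_def)
      moreover have "Poly_Mapping.lookup l i = Suc (Poly_Mapping.lookup m i)"
        using arg_cong[OF eq, of "\<lambda>q. Poly_Mapping.lookup q i"] \<open>j \<noteq> i\<close>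
        by (simp add: lookup_add lookup_single)
      ultimately show False using m_max by fastforce
    qed
    then show ?thesis by (simp add: lookup_indet_mult)
  qed
  then have "Poly_Mapping.lookup (linear_form b * p) ?k =
      (\<Sum>j\<in>UNIV. if j = i then b i * Poly_Mapping.lookup p m else 0)"
    unfolding linear_form_mult lookup_sum lookup_cpoly_scale
    by (intro sum.cong refl) (use lookup_indet_mult_shift[of i p m] in auto)
  also have "\<dots> \<noteq> 0" using b m by (simp add: T_def in_keys_iff)
  finally have "?k \<in> Poly_Mapping.keys (linear_form b * p)" by (simp add: in_keys_iff)
  then have "mdegree ?k \<le> n" using Lp by (auto simp: mem_polys_upto_iff)
  then show False using m by (simp add: mdegree_add T_def)
qed

section \<open>Direct sums and their projectors\<close>

text \<open>
  The next two lemmas trade the exact support in \<open>is_decomp\<close> for any finite set containing it. This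
  is what makes decompositions of two polynomials comparable, since their supports may differ.
\<close>

lemma is_decompI:
  assumes "\<And>i. i \<in> I \<Longrightarrow> f i \<in> F i" "\<And>i. i \<notin> I \<Longrightarrow> f i = 0"
    and "finite S" "\<And>i. i \<notin> S \<Longrightarrow> f i = 0" "p = sum f S"
  shows "is_decomp I F p f"
proof -
  have sub: "{i. f i \<noteq> 0} \<subseteq> S" using assms(4) by auto
  then have "finite {i. f i \<noteq> 0}" using \<open>finite S\<close> finite_subset by blast
  moreover have "sum f {i. f i \<noteq> 0} = sum f S"
    using sub \<open>finite S\<close> by (intro sum.mono_neutral_left) auto
  ultimately show ?thesis using assms by (auto simp: is_decomp_def)
qed

lemma is_decomp_sum:
  assumes "is_decomp I F p f" "finite S" "\<And>i. f i \<noteq> 0 \<Longrightarrow> i \<in> S"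
  shows "p = sum f S"
proof -
  have "p = sum f {i. f i \<noteq> 0}" using assms(1) by (simp add: is_decomp_def)
  also have "\<dots> = sum f S" using assms(2,3) by (intro sum.mono_neutral_left) auto
  finally show ?thesis .
qed

lemma is_decomp_projector:
  assumes "is_direct_sum UNIV P UNIV"
  shows "is_decomp UNIV P p (\<lambda>n. projector P n p)"
proof -
  have "\<exists>!f. is_decomp UNIV P p f" using assms by (simp add: is_direct_sum_def)
  then show ?thesis unfolding projector_def by (rule theI')
qed

lemma projector_eqI:
  assumes "is_direct_sum UNIV P UNIV" "is_decomp UNIV P p f"
  shows "projector P n p = f n"
proof -
  have "\<exists>!f. is_decomp UNIV P p f" using assms(1) by (simp add: is_direct_sum_def)
  then show ?thesis unfolding projector_def using assms(2) by (metis the1_equality)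
qed

lemma projector_mem:
  "is_direct_sum UNIV P UNIV \<Longrightarrow> projector P n p \<in> P n"
  using is_decomp_projector by (auto simp: is_decomp_def)

lemma finite_projector_support:
  "is_direct_sum UNIV P UNIV \<Longrightarrow> finite {n. projector P n p \<noteq> 0}"
  using is_decomp_projector by (auto simp: is_decomp_def)

lemma projectors_determine:
  assumes "is_direct_sum UNIV P UNIV" "\<And>n. projector P n p = projector P n q"
  shows "p = q"
  using is_decomp_projector[OF assms(1), of p] is_decomp_projector[OF assms(1), of q] assms(2)
  by (simp add: is_decomp_def)

lemma projector_of_mem:
  assumes D: "is_direct_sum UNIV P UNIV" and "p \<in> P k"
  shows "projector P n p = (if n = k then p else 0)"
proof -
  have "is_decomp UNIV P p (\<lambda>n. if n = k then p else 0)"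
    using assms
    by (intro is_decompI[where S = "{k}"]) (auto simp: is_direct_sum_def cpoly.subspace_0)
  then show ?thesis by (rule projector_eqI[OF D])
qed

lemma projector_add:
  assumes D: "is_direct_sum UNIV P UNIV"
  shows "projector P n (p + q) = projector P n p + projector P n q"
proof -
  let ?S = "{n. projector P n p \<noteq> 0} \<union> {n. projector P n q \<noteq> 0}"
  have S: "finite ?S" using D by (simp add: finite_projector_support)
  have "p = (\<Sum>n\<in>?S. projector P n p)" "q = (\<Sum>n\<in>?S. projector P n q)"
    by (rule is_decomp_sum[OF is_decomp_projector[OF D] S]; simp)+
  then have "p + q = (\<Sum>n\<in>?S. projector P n p + projector P n q)"
    by (simp add: sum.distrib)
  moreover have "projector P n p + projector P n q \<in> P n" for n
    using D projector_mem[OF D] by (simp add: is_direct_sum_def cpoly.subspace_add)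
  ultimately have "is_decomp UNIV P (p + q) (\<lambda>n. projector P n p + projector P n q)"
    using S by (intro is_decompI[where S = ?S]) auto
  then show ?thesis by (rule projector_eqI[OF D])
qed

lemma projector_scale:
  assumes D: "is_direct_sum UNIV P UNIV"
  shows "projector P n (cpoly_scale c p) = cpoly_scale c (projector P n p)"
proof -
  let ?S = "{n. projector P n p \<noteq> 0}"
  have S: "finite ?S" using D by (rule finite_projector_support)
  have "p = (\<Sum>n\<in>?S. projector P n p)"
    by (rule is_decomp_sum[OF is_decomp_projector[OF D] S]) simp
  then have "cpoly_scale c p = (\<Sum>n\<in>?S. cpoly_scale c (projector P n p))"
    by (metis cpoly.scale_sum_right)
  moreover have "cpoly_scale c (projector P n p) \<in> P n" for n
    using D projector_mem[OF D] by (simp add: is_direct_sum_def cpoly.subspace_scale)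
  ultimately have "is_decomp UNIV P (cpoly_scale c p) (\<lambda>n. cpoly_scale c (projector P n p))"
    using S by (intro is_decompI[where S = ?S]) auto
  then show ?thesis by (rule projector_eqI[OF D])
qed

lemma projector_diff:
  assumes D: "is_direct_sum UNIV P UNIV"
  shows "projector P n (p - q) = projector P n p - projector P n q"
  using projector_add[OF D, of n "p - q" q] by simp

lemma projector_zero:
  assumes D: "is_direct_sum UNIV P UNIV"
  shows "projector P n 0 = 0"
  using projector_diff[OF D, of n 0 0] by simp

lemma projector_sum:
  assumes D: "is_direct_sum UNIV P UNIV"
  shows "projector P n (sum g A) = (\<Sum>a\<in>A. projector P n (g a))"
proof (induction A rule: infinite_finite_induct)
  case (insert a A)
  then show ?case by (simp add: projector_add[OF D])
qed (simp_all add: projector_zero[OF D])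

section \<open>Top components in an orthogonal decomposition\<close>

text \<open>
  The decompositions of \<open>polys_upto n\<close> for the various \<open>n\<close> are all restrictions of the one of the
  whole polynomial algebra, so dropping a vanishing top component lowers the degree bound.
\<close>

lemma projector_eq_0_imp_lower_degree:
  assumes D: "is_direct_sum UNIV P UNIV"
    and filt: "\<And>n. is_direct_sum {0..n} P (polys_upto (int n))"
    and q: "q \<in> polys_upto (int (Suc n))" and top: "projector P (Suc n) q = 0"
  shows "q \<in> polys_upto (int n)"
proof -
  obtain f where f: "is_decomp {0..Suc n} P q f"
    using filt[of "Suc n"] q unfolding is_direct_sum_def by blast
  have "0 \<in> P i" for i using D by (simp add: is_direct_sum_def cpoly.subspace_0)
  then have mem: "f i \<in> P i" for i
    using f unfolding is_decomp_def by metis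
  then have "is_decomp UNIV P q f" using f by (simp add: is_decomp_def)
  then have "f (Suc n) = 0" using projector_eqI[OF D] top by metis
  then have "f i = 0" if "i \<notin> {0..n}" for i
    using f that unfolding is_decomp_def by (cases "i = Suc n") auto
  then have "is_decomp {0..n} P q f"
    using f mem by (simp add: is_decomp_def)
  then show ?thesis using filt[of n] unfolding is_direct_sum_def by blast
qed

text \<open>
  An element of both summands of a direct sum would have two decompositions, with the element placed
  in either summand.
\<close>

lemma monic_inter_lower_degree:
  fixes D :: "('d::finite) cpoly set"
  assumes "is_monic n D" "p \<in> D" "p \<in> polys_upto (int n - 1)"
  shows "p = 0"
proof -
  let ?F = "case_bool (polys_upto (int n - 1)) D"
  have ds: "is_direct_sum UNIV ?F (polys_upto (int n))"
    and "p \<in> polys_upto (int n)"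
    using assms by (auto simp: is_monic_def)
  have "0 \<in> ?F i" for i
    using ds cpoly.subspace_0 unfolding is_direct_sum_def by blast
  from this[of True] this[of False] have "(0 :: 'd cpoly) \<in> polys_upto (int n - 1)" "0 \<in> D" by simp_all
  then have "is_decomp UNIV ?F p (case_bool p 0)" "is_decomp UNIV ?F p (case_bool 0 p)"
    using assms(2,3)
    by (intro is_decompI[where S = UNIV];
        auto simp: UNIV_bool split: bool.splits)+
  then have "case_bool p 0 = case_bool 0 p"
    using ds \<open>p \<in> polys_upto (int n)\<close> unfolding is_direct_sum_def by blast
  then show ?thesis by (metis bool.case(1))
qed

lemma raising_injective_on_component:
  assumes P: "orthogonal_poly_decomposition \<phi> P"
    and b: "b i \<noteq> 0" and \<xi>: "\<xi> \<in> P n"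
    and zero: "projector P (Suc n) (linear_form b * \<xi>) = 0"
  shows "\<xi> = 0"
proof -
  have D: "is_direct_sum UNIV P UNIV"
    and filt: "\<And>n. is_direct_sum {0..n} P (polys_upto (int n))" and monic: "is_monic n (P n)"
    using P by (auto simp: orthogonal_poly_decomposition_def)
  have deg: "\<xi> \<in> polys_upto (int n)" using monic \<xi> by (auto simp: is_monic_def)
  then have "linear_form b * \<xi> \<in> polys_upto (int (Suc n))"
    using linear_form_mult_mem_polys_upto[of \<xi> "int n" b] by (simp add: add.commute)
  then have "linear_form b * \<xi> \<in> polys_upto (int n)"
    using projector_eq_0_imp_lower_degree[OF D filt _ zero] by blast
  then have "\<xi> \<in> polys_upto (int n - 1)"
    using linear_form_mult_raises_degree b deg by blast
  then show ?thesis using monic_inter_lower_degree monic \<xi> by blast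
qed

section \<open>The creation operator shifts the grading\<close>

text \<open>
  The summand of \<open>creator P j p\<close> that comes from the component of index \<open>k\<close> lies in \<open>P (k + 1)\<close>, so
  the projection onto \<open>P (n + 1)\<close> keeps exactly the one with \<open>k = n\<close>.
\<close>

lemma projector_creator:
  assumes D: "is_direct_sum UNIV P UNIV"
  shows "projector P (Suc n) (creator P j p) = projector P (Suc n) (indet j * projector P n p)"
proof -
  let ?S = "{k. projector P k p \<noteq> 0}"
  have S: "finite ?S" using D by (rule finite_projector_support)
  have at: "projector P (Suc n) (creator_at P j k (projector P k p)) =
      (if k = n then projector P (Suc n) (indet j * projector P n p) else 0)" for k
    unfolding creator_at_def
    by (simp add: projector_of_mem[OF D projector_mem[OF D]])
  have "projector P (Suc n) (creator P j p) =
      (\<Sum>k\<in>?S. if k = n then projector P (Suc n) (indet j * projector P n p) else 0)"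
    unfolding creator_def projector_sum[OF D] at ..
  also have "\<dots> = projector P (Suc n) (indet j * projector P n p)"
    using S by (cases "projector P n p = 0") (auto simp: projector_zero[OF D])
  finally show ?thesis .
qed

lemma projector_creator_vec:
  assumes D: "is_direct_sum UNIV P UNIV"
  shows "projector P (Suc n) (creator_vec scaleV e P v p) =
    projector P (Suc n)
      (linear_form (\<lambda>j. module.representation scaleV (range e) v (e j)) * projector P n p)"
  unfolding creator_vec_def linear_form_mult
  by (simp add: projector_sum[OF D] projector_scale[OF D] projector_creator[OF D])

lemma (in vector_space) nonzero_coordinate:
  fixes e :: "'i::finite \<Rightarrow> 'b"
  assumes "independent (range e)" "span (range e) = UNIV" "v \<noteq> 0"
  obtains i where "representation (range e) v (e i) \<noteq> 0"
proof -
  have "(\<Sum>u\<in>range e. scale (representation (range e) v u) u) = v"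
    using assms(1,2) by (intro sum_representation_eq) auto
  then have "\<exists>u\<in>range e. representation (range e) v u \<noteq> 0"
    using \<open>v \<noteq> 0\<close> by (metis (no_types, lifting) scale_zero_left sum.neutral)
  then show ?thesis using that by blast
qed


theorem theorem3:
  fixes \<phi> :: "('d::finite) cpoly \<Rightarrow> complex"
    and P :: "nat \<Rightarrow> 'd cpoly set"
    and scaleV :: "complex \<Rightarrow> 'v::ab_group_add \<Rightarrow> 'v"
    and cinner :: "'v \<Rightarrow> 'v \<Rightarrow> complex"
    and e :: "'d \<Rightarrow> 'v"
    and v :: 'v
  assumes "is_state \<phi>"
    and "orthogonal_poly_decomposition \<phi> P"
    and "complex_hilbert_space scaleV cinner"
    and "is_indexed_basis scaleV e"
    and "v \<noteq> 0"
  shows "inj (creator_vec scaleV e P v) \<and>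
         (\<forall>n. \<forall>\<xi>\<in>P n. creator_vec scaleV e P v \<xi> = 0 \<longrightarrow> \<xi> = 0)"
proof -
  interpret complex_hilbert_space scaleV cinner by fact
  let ?b = "\<lambda>j. representation (range e) v (e j)"
  obtain i where b: "?b i \<noteq> 0"
    using nonzero_coordinate assms(4,5) unfolding is_indexed_basis_def by blast
  have D: "is_direct_sum UNIV P UNIV"
    using assms(2) by (simp add: orthogonal_poly_decomposition_def)
  note shift = projector_creator_vec[OF D, of _ scaleV e v]
  have "inj (creator_vec scaleV e P v)"
  proof (rule injI, rule projectors_determine[OF D])
    fix p q n
    assume eq: "creator_vec scaleV e P v p = creator_vec scaleV e P v q"
    let ?\<xi> = "projector P n (p - q)"
    have "projector P (Suc n) (linear_form ?b * ?\<xi>) = 0"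
      using shift[of n p] shift[of n q] eq
      by (simp add: projector_diff[OF D] right_diff_distrib)
    then have "?\<xi> = 0"
      by (rule raising_injective_on_component[OF assms(2), of ?b, OF b projector_mem[OF D]])
    then show "projector P n p = projector P n q"
      by (simp add: projector_diff[OF D])
  qed
  \<comment> \<open>Hence the claim for a single component is an instance of injectivity.\<close>
  moreover have "creator_vec scaleV e P v 0 = 0"
    by (simp add: creator_vec_def creator_def projector_zero[OF D])
  ultimately show ?thesis by (metis injD)
qed

end
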